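(* Let $n\ge 2$, let $G=(V,E)$ be a complete graph on $n$ vertices with distinct positive edge weights, and let $k\in\{1,2,\dots,n-1\}$. Define \[ M_k(G)=\bigcup_{X\subseteq V,\ |X|=k-1}\mathrm{MST}(G[V\setminus X]). \] Then $|M_k(G)|\le nk-\binom{k+1}{2}$.
   Context: For $X\subseteq V$, $G[V\setminus X]$ denotes the subgraph of $G$ induced by $V\setminus X$, with the inherited edge weights. $\mathrm{MST}(H)$ denotes the set of edges of the minimum-weight spanning tree of a connected weighted graph $H$; it is unique because the edge weights are distinct. *)

theory Defs
  imports Complex_Main
begin

text \<open>Simple undirected graphs: edges are 2-element vertex sets.
  The complete graph on S has edge set all_edges S.\<close>

definition all_edges :: "'a set \<Rightarrow> 'a set set" where
  "all_edges S = {e. e \<subseteq> S \<and> card e = 2}"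

text \<open>Adjacency relation induced by an edge set.\<close>
definition adj :: "'a set set \<Rightarrow> ('a \<times> 'a) set" where
  "adj T = {(u, v). {u, v} \<in> T}"

text \<open>The graph (S, T) is connected.\<close>
definition connected_on :: "'a set \<Rightarrow> 'a set set \<Rightarrow> bool" where
  "connected_on S T \<longleftrightarrow> (\<forall>u\<in>S. \<forall>v\<in>S. (u, v) \<in> (adj T)\<^sup>*)"

text \<open>Acyclic: no edge has its endpoints joined by a path avoiding it.\<close>
definition acyclic_edges :: "'a set set \<Rightarrow> bool" where
  "acyclic_edges T \<longleftrightarrow>
     (\<forall>u v. {u, v} \<in> T \<longrightarrow> (u, v) \<notin> (adj (T - {{u, v}}))\<^sup>*)"

text \<open>T is (the edge set of) a spanning tree of the complete graph on S.\<close>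
definition spanning_tree :: "'a set \<Rightarrow> 'a set set \<Rightarrow> bool" where
  "spanning_tree S T \<longleftrightarrow> T \<subseteq> all_edges S \<and> connected_on S T \<and> acyclic_edges T"

text \<open>Edge set of the minimum-weight spanning tree of the complete graph on S
  with weights w (unique when weights are distinct).\<close>
definition MST :: "('a set \<Rightarrow> real) \<Rightarrow> 'a set \<Rightarrow> 'a set set" where
  "MST w S = (THE T. spanning_tree S T \<and>
      (\<forall>T'. spanning_tree S T' \<longrightarrow> sum w T \<le> sum w T'))"

text \<open>M_k(G): union of MSTs of G[V - X] over all X \<subseteq> V with |X| = k - 1.\<close>
definition M :: "('a set \<Rightarrow> real) \<Rightarrow> 'a set \<Rightarrow> nat \<Rightarrow> 'a set set" where
  "M w V k = (\<Union>X\<in>{X. X \<subseteq> V \<and> card X = k - 1}. MST w (V - X))"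

end

theory Submission
  imports Defs "HOL-Computational_Algebra.Polynomial"
begin

text \<open>An edge uv lies in the minimum spanning tree of \<open>G[V - X]\<close> iff X separates u from v in the
  graph of all edges lighter than uv; let A be the side of u. Give the vertices distinct real labels \<open>t v\<close> and place
  them on the moment curve, \<open>p v = (1, t v, ..., t v ^ (k-1))\<close>. Let a be the coefficient vector of the
  polynomial q with roots t x, \<open>x \<in> X\<close>, so that \<open>a \<bullet> p v = q (t v)\<close> vanishes exactly for v in X.
  To the edge assign the motion \<open>v \<mapsto> (a \<bullet> p v) a\<close> on A and 0 elsewhere, a vector in \<open>(\<real>^k)^V\<close>.
  The functional \<open>m \<mapsto> p y \<bullet> m x - p x \<bullet> m y\<close> of an edge xy is zero on this motion if xy is lighter
  than uv, and nonzero if xy = uv. All these functionals vanish on the motions \<open>v \<mapsto> S (p v)\<close> with S a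
  symmetric matrix, which form a space of dimension (k+1 choose 2). Hence the motions of the edges are
  linearly independent modulo that space, in total dimension nk. (These functionals are the rows of
  Kalai's hyperconnectivity matrix.)\<close>

section \<open>Minimum spanning trees\<close>

lemma sym_adj_rtrancl: "sym ((adj T)\<^sup>*)"
  by (rule sym_rtrancl) (auto simp: sym_def adj_def insert_commute)

lemma adj_rtrancl_sym: "(u, v) \<in> (adj T)\<^sup>* \<Longrightarrow> (v, u) \<in> (adj T)\<^sup>*"
  using sym_adj_rtrancl by (metis symD)

lemma adj_rtrancl_mono: "(u, v) \<in> (adj T)\<^sup>* \<Longrightarrow> T \<subseteq> T' \<Longrightarrow> (u, v) \<in> (adj T')\<^sup>*"
  by (rule rtrancl_mono[THEN subsetD, of "adj T"]) (auto simp: adj_def)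

lemma adj_rtrancl_edge: "{u, v} \<in> T \<Longrightarrow> (u, v) \<in> (adj T)\<^sup>*"
  by (auto simp: adj_def)

text \<open>Each use of the edge \<open>{x, y}\<close> on the walk is rerouted along the connection
  that \<open>T'\<close> provides.\<close>

lemma adj_rtrancl_replace:
  assumes uv: "(u, v) \<in> (adj T)\<^sup>*" and sub: "T - {{x, y}} \<subseteq> T'" and xy: "(x, y) \<in> (adj T')\<^sup>*"
  shows "(u, v) \<in> (adj T')\<^sup>*"
  using uv
proof (induction rule: rtrancl_induct)
  case (step a b)
  have "(a, b) \<in> (adj T')\<^sup>*"
  proof (cases "{a, b} = {x, y}")
    case True
    then show ?thesis using xy adj_rtrancl_sym[OF xy] by (auto simp: doubleton_eq_iff)
  next
    case False
    then show ?thesis using step(2) sub by (intro adj_rtrancl_edge) (auto simp: adj_def)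
  qed
  with step.IH show ?case by (rule rtrancl_trans)
qed simp

lemma connected_on_replace:
  assumes "connected_on S T" "T - {{x, y}} \<subseteq> T'" "(x, y) \<in> (adj T')\<^sup>*"
  shows "connected_on S T'"
  using assms unfolding connected_on_def by (meson adj_rtrancl_replace)

text \<open>Following the walk, the current vertex is always reached either without
  \<open>{x, y}\<close> or by a single crossing of it in one of the two directions; further
  crossings collapse to one of these cases.\<close>

lemma adj_rtrancl_bridge:
  assumes uv: "(u, v) \<in> (adj T)\<^sup>*" and not: "(u, v) \<notin> (adj (T - {{x, y}}))\<^sup>*"
  shows "(u, x) \<in> (adj (T - {{x, y}}))\<^sup>* \<and> (y, v) \<in> (adj (T - {{x, y}}))\<^sup>* \<or>
         (u, y) \<in> (adj (T - {{x, y}}))\<^sup>* \<and> (x, v) \<in> (adj (T - {{x, y}}))\<^sup>*"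
proof -
  let ?R = "(adj (T - {{x, y}}))\<^sup>*"
  have "(u, v) \<in> ?R \<or> (u, x) \<in> ?R \<and> (y, v) \<in> ?R \<or> (u, y) \<in> ?R \<and> (x, v) \<in> ?R"
    using uv
  proof (induction rule: rtrancl_induct)
    case (step a b)
    show ?case
    proof (cases "{a, b} = {x, y}")
      case True
      then have "a = x \<and> b = y \<or> a = y \<and> b = x" by (auto simp: doubleton_eq_iff)
      then show ?thesis using step.IH by (metis rtrancl.rtrancl_refl)
    next
      case False
      then have "(a, b) \<in> ?R" using step(2) by (intro adj_rtrancl_edge) (auto simp: adj_def)
      then show ?thesis using step.IH by (meson rtrancl_trans)
    qed
  qed simp
  then show ?thesis using not by blast
qed

lemma adj_rtrancl_crossing:
  assumes "(u, v) \<in> (adj T)\<^sup>*" "P u" "\<not> P v"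
  obtains x y where "{x, y} \<in> T" "P x" "\<not> P y"
proof -
  have "\<exists>x y. {x, y} \<in> T \<and> P x \<and> \<not> P y"
    using assms(1,3)
  proof (induction rule: rtrancl_induct)
    case base
    then show ?case using assms(2) by simp
  next
    case (step a b)
    then show ?case by (cases "P a") (auto simp: adj_def)
  qed
  then show ?thesis using that by blast
qed

section \<open>Edges of complete graphs and extraction of spanning trees\<close>

lemma adj_rtrancl_all_edges:
  assumes "(u, v) \<in> (adj T)\<^sup>*" "T \<subseteq> all_edges S" "u \<in> S"
  shows "v \<in> S"
  using assms(1)
  by (induction rule: rtrancl_induct) (use assms in \<open>auto simp: adj_def all_edges_def\<close>)

lemma finite_all_edges: "finite S \<Longrightarrow> finite (all_edges S)"
  by (rule finite_subset[of _ "Pow S"]) (auto simp: all_edges_def)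

lemma all_edges_mono: "S \<subseteq> S' \<Longrightarrow> all_edges S \<subseteq> all_edges S'"
  by (auto simp: all_edges_def)

lemma all_edges_doubleton_iff: "{u, v} \<in> all_edges S \<longleftrightarrow> u \<in> S \<and> v \<in> S \<and> u \<noteq> v"
  by (cases "u = v") (auto simp: all_edges_def)

lemma all_edgesE:
  assumes "e \<in> all_edges S"
  obtains u v where "e = {u, v}" "u \<in> S" "v \<in> S" "u \<noteq> v"
  using assms by (auto simp: all_edges_def card_2_iff)

lemma connected_on_all_edges: "connected_on S (all_edges S)"
  unfolding connected_on_def
proof (intro ballI)
  fix u v assume "u \<in> S" "v \<in> S"
  then show "(u, v) \<in> (adj (all_edges S))\<^sup>*"
    by (cases "u = v") (auto intro: adj_rtrancl_edge simp: all_edges_doubleton_iff)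
qed

text \<open>An edge whose endpoints stay joined without it can be deleted without losing
  connectivity; as \<open>C\<close> is finite, this stops at an acyclic set.\<close>

lemma connected_on_contains_spanning_tree:
  assumes "finite C" "C \<subseteq> all_edges S" "connected_on S C"
  obtains T where "T \<subseteq> C" "spanning_tree S T"
proof -
  have "\<exists>T\<subseteq>C. spanning_tree S T"
    using assms
  proof (induction C rule: finite_psubset_induct)
    case (psubset C)
    show ?case
    proof (cases "acyclic_edges C")
      case True
      then show ?thesis using psubset.prems by (auto simp: spanning_tree_def)
    next
      case False
      then obtain u v where uv: "{u, v} \<in> C" "(u, v) \<in> (adj (C - {{u, v}}))\<^sup>*"
        by (auto simp: acyclic_edges_def)
      have "connected_on S (C - {{u, v}})"
        using psubset.prems(2) uv(2) by (rule connected_on_replace[OF _ order_refl])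
      moreover have "C - {{u, v}} \<subset> C" using uv(1) by blast
      ultimately obtain T where "T \<subseteq> C - {{u, v}}" "spanning_tree S T"
        using psubset.IH[of "C - {{u, v}}"] psubset.prems(1) by blast
      then show ?thesis by blast
    qed
  qed
  then show ?thesis using that by blast
qed

section \<open>Minimum spanning trees through the bottleneck criterion\<close>

definition lighter :: "('a set \<Rightarrow> real) \<Rightarrow> 'a set \<Rightarrow> 'a set \<Rightarrow> 'a set set" where
  "lighter w S e = {f \<in> all_edges S. w f < w e}"

text \<open>For distinct weights these are the edges that are heaviest on no cycle, which Kruskal's
  algorithm keeps. The criterion tests each edge by itself, without reference to a tree.\<close>

definition bottleneck_edges :: "('a set \<Rightarrow> real) \<Rightarrow> 'a set \<Rightarrow> 'a set set" where
  "bottleneck_edges w S =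
     {e \<in> all_edges S. \<forall>u v. e = {u, v} \<longrightarrow> (u, v) \<notin> (adj (lighter w S e))\<^sup>*}"

definition min_spanning_tree :: "('a set \<Rightarrow> real) \<Rightarrow> 'a set \<Rightarrow> 'a set set \<Rightarrow> bool" where
  "min_spanning_tree w S T \<longleftrightarrow>
     spanning_tree S T \<and> (\<forall>T'. spanning_tree S T' \<longrightarrow> sum w T \<le> sum w T')"

lemma ex_min_spanning_tree:
  assumes "finite S"
  shows "\<exists>T. min_spanning_tree w S T"
proof -
  let ?Ts = "{T. spanning_tree S T}"
  have "finite ?Ts"
    by (rule finite_subset[of _ "Pow (all_edges S)"])
      (auto simp: spanning_tree_def finite_all_edges assms)
  moreover have "?Ts \<noteq> {}"
    using connected_on_contains_spanning_tree[OF finite_all_edges[OF assms] order_refl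
        connected_on_all_edges] by blast
  ultimately have "arg_min_on (sum w) ?Ts \<in> ?Ts"
      "\<forall>T\<in>?Ts. sum w (arg_min_on (sum w) ?Ts) \<le> sum w T"
    using arg_min_if_finite(1)[of ?Ts "sum w"] arg_min_least[of ?Ts _ "sum w"] by simp_all
  then show ?thesis unfolding min_spanning_tree_def by blast
qed

text \<open>Because the weights are positive, a minimum spanning tree is optimal even among all connected
  edge sets; this spares us the verification that exchanging edges preserves acyclicity.\<close>

lemma min_spanning_tree_le_connected:
  assumes "finite S" "\<And>e. e \<in> all_edges S \<Longrightarrow> w e > 0" "min_spanning_tree w S T"
    and "C \<subseteq> all_edges S" "connected_on S C"
  shows "sum w T \<le> sum w C"
proof -
  have fin: "finite C" using assms(1,4) finite_all_edges finite_subset by blast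
  obtain T' where T': "T' \<subseteq> C" "spanning_tree S T'"
    using connected_on_contains_spanning_tree[OF fin assms(4,5)] .
  have "sum w T \<le> sum w T'" using assms(3) T'(2) by (auto simp: min_spanning_tree_def)
  also have "\<dots> \<le> sum w C"
    using assms(2,4) by (intro sum_mono2 fin T'(1)) (auto intro: less_imp_le)
  finally show ?thesis .
qed

text \<open>Otherwise the exchanged edge set would still be connected, yet cheaper than
  \<open>T\<close>.\<close>

lemma min_spanning_tree_exchange:
  assumes "finite S" "\<And>e. e \<in> all_edges S \<Longrightarrow> w e > 0" "min_spanning_tree w S T"
    and "{x, y} \<in> T" "g \<in> all_edges S" "w g < w {x, y}"
  shows "(x, y) \<notin> (adj (insert g (T - {{x, y}})))\<^sup>*"
proof
  let ?C = "insert g (T - {{x, y}})"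
  assume xy: "(x, y) \<in> (adj ?C)\<^sup>*"
  have T: "T \<subseteq> all_edges S" "connected_on S T"
    using assms(3) by (auto simp: min_spanning_tree_def spanning_tree_def)
  have fin: "finite T" using T(1) assms(1) finite_all_edges finite_subset by blast
  have "connected_on S ?C" by (rule connected_on_replace[OF T(2) _ xy]) blast
  then have "sum w T \<le> sum w ?C"
    using T(1) assms(5) by (intro min_spanning_tree_le_connected[OF assms(1-3)]) auto
  \<comment> \<open>Only an inequality, since \<open>g\<close> may already lie in
    \<open>T - {{x, y}}\<close>; then positivity of \<open>w g\<close> is used.\<close>
  moreover have "sum w ?C \<le> w g + sum w (T - {{x, y}})"
    using assms(2)[OF assms(5)] fin by (cases "g \<in> T - {{x, y}}") (auto simp: sum.insert_if)
  moreover have "sum w T = w {x, y} + sum w (T - {{x, y}})"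
    using fin assms(4) by (rule sum.remove)
  ultimately show False using assms(6) by simp
qed

text \<open>Both inclusions are exchanges. A tree edge bridged by lighter edges could be swapped for
  one of them; a bottleneck edge outside \<open>T\<close> could replace a heavier edge on the tree
  path between its ends.\<close>

lemma min_spanning_tree_eq_bottleneck_edges:
  assumes "finite S" "\<And>e. e \<in> all_edges S \<Longrightarrow> w e > 0" "inj_on w (all_edges S)"
    and T: "min_spanning_tree w S T"
  shows "T = bottleneck_edges w S"
proof
  have T': "T \<subseteq> all_edges S" "connected_on S T" "acyclic_edges T"
    using T by (auto simp: min_spanning_tree_def spanning_tree_def)
  show "T \<subseteq> bottleneck_edges w S"
  proof
    fix e assume e: "e \<in> T"
    show "e \<in> bottleneck_edges w S"
    proof (rule ccontr)
      assume "e \<notin> bottleneck_edges w S"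
      then obtain u v where uv: "e = {u, v}" "(u, v) \<in> (adj (lighter w S e))\<^sup>*"
        using e T'(1) by (auto simp: bottleneck_edges_def)
      have nuv: "(u, v) \<notin> (adj (T - {{u, v}}))\<^sup>*"
        using T'(3) e uv(1) by (auto simp: acyclic_edges_def)
      \<comment> \<open>Deleting \<open>e\<close> splits the tree; the lighter walk from
        \<open>u\<close> to \<open>v\<close> must leave the component of \<open>u\<close> through
        some edge \<open>{x, y}\<close>.\<close>
      obtain x y where xy: "{x, y} \<in> lighter w S e"
          "(u, x) \<in> (adj (T - {{u, v}}))\<^sup>*" "(u, y) \<notin> (adj (T - {{u, v}}))\<^sup>*"
        by (rule adj_rtrancl_crossing[OF uv(2), of "\<lambda>z. (u, z) \<in> (adj (T - {{u, v}}))\<^sup>*"])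
          (use nuv in auto)
      have "u \<in> S" "y \<in> S"
        using e T'(1) uv(1) xy(1) by (auto simp: lighter_def all_edges_doubleton_iff)
      then have "(u, y) \<in> (adj T)\<^sup>*" using T'(2) by (auto simp: connected_on_def)
      then have yv: "(v, y) \<in> (adj (T - {{u, v}}))\<^sup>*"
        using adj_rtrancl_bridge[OF _ xy(3)] nuv by blast
      let ?C = "insert {x, y} (T - {{u, v}})"
      have "(u, x) \<in> (adj ?C)\<^sup>*" "(y, v) \<in> (adj ?C)\<^sup>*"
        using xy(2) adj_rtrancl_sym[OF yv] by (auto intro: adj_rtrancl_mono)
      moreover have "(x, y) \<in> (adj ?C)\<^sup>*" by (rule adj_rtrancl_edge) simp
      ultimately have "(u, v) \<in> (adj ?C)\<^sup>*" by (meson rtrancl_trans)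
      moreover have "{x, y} \<in> all_edges S" "w {x, y} < w {u, v}"
        using xy(1) uv(1) by (auto simp: lighter_def)
      ultimately show False
        using min_spanning_tree_exchange[OF assms(1,2) T] e uv(1) by metis
    qed
  qed
  show "bottleneck_edges w S \<subseteq> T"
  proof (rule subsetI, rule ccontr)
    fix e assume e: "e \<in> bottleneck_edges w S" "e \<notin> T"
    then obtain u v where uv: "e = {u, v}" "u \<in> S" "v \<in> S"
      by (auto simp: bottleneck_edges_def elim: all_edgesE)
    \<comment> \<open>An inclusion-minimal member \<open>D\<close> stands in for the tree path from
      \<open>u\<close> to \<open>v\<close>: deleting any edge of \<open>D\<close> separates
      them.\<close>
    define Ds where "Ds = {D. D \<subseteq> T \<and> (u, v) \<in> (adj D)\<^sup>*}"
    have "T \<in> Ds"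
      using T'(2) uv by (auto simp: Ds_def connected_on_def)
    moreover have "finite Ds"
      using finite_subset[OF T'(1) finite_all_edges[OF assms(1)]] by (simp add: Ds_def)
    ultimately obtain D where "D \<in> Ds" and D_min: "\<forall>D'\<in>Ds. D' \<subseteq> D \<longrightarrow> D = D'"
      using finite_has_minimal[of Ds] by auto
    then have D: "D \<subseteq> T" "(u, v) \<in> (adj D)\<^sup>*" by (auto simp: Ds_def)
    have "\<not> D \<subseteq> lighter w S e"
      using e(1) uv(1) adj_rtrancl_mono[OF D(2), of "lighter w S e"]
      by (auto simp: bottleneck_edges_def)
    then obtain f where f: "f \<in> D" "f \<notin> lighter w S e" by blast
    have fS: "f \<in> all_edges S" using f(1) D(1) T'(1) by blast
    have eS: "e \<in> all_edges S" using e(1) by (simp add: bottleneck_edges_def)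
    have "f \<noteq> e" using f(1) D(1) e(2) by blast
    then have "w f \<noteq> w e" using assms(3) fS eS by (auto dest: inj_onD)
    then have less: "w e < w f" using f(2) fS by (auto simp: lighter_def)
    obtain x y where xy: "f = {x, y}" using fS by (rule all_edgesE)
    have "(u, v) \<notin> (adj (D - {{x, y}}))\<^sup>*"
    proof
      assume "(u, v) \<in> (adj (D - {{x, y}}))\<^sup>*"
      then have "D - {{x, y}} \<in> Ds" using D(1) by (auto simp: Ds_def)
      then have "D = D - {{x, y}}" using D_min by blast
      then show False using f(1) xy by blast
    qed
    from adj_rtrancl_bridge[OF D(2) this]
    have "(u, x) \<in> (adj (D - {{x, y}}))\<^sup>* \<and> (y, v) \<in> (adj (D - {{x, y}}))\<^sup>* \<or>
          (u, y) \<in> (adj (D - {{x, y}}))\<^sup>* \<and> (x, v) \<in> (adj (D - {{x, y}}))\<^sup>*" .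
    moreover let ?C = "insert e (T - {{x, y}})"
    have sub: "D - {{x, y}} \<subseteq> ?C" using D(1) by blast
    ultimately have "(u, x) \<in> (adj ?C)\<^sup>* \<and> (y, v) \<in> (adj ?C)\<^sup>* \<or>
          (u, y) \<in> (adj ?C)\<^sup>* \<and> (x, v) \<in> (adj ?C)\<^sup>*"
      using adj_rtrancl_mono[OF _ sub] by blast
    moreover have "(u, v) \<in> (adj ?C)\<^sup>*" using uv(1) by (intro adj_rtrancl_edge) simp
    ultimately have "(x, y) \<in> (adj ?C)\<^sup>*" by (meson adj_rtrancl_sym rtrancl_trans)
    then show False
      using min_spanning_tree_exchange[OF assms(1,2) T, of x y e] f(1) D(1) xy eS less by blast
  qed
qed

lemma MST_eq_bottleneck_edges:
  assumes "finite S" "\<And>e. e \<in> all_edges S \<Longrightarrow> w e > 0" "inj_on w (all_edges S)"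
  shows "MST w S = bottleneck_edges w S"
proof -
  obtain T where T: "min_spanning_tree w S T" using ex_min_spanning_tree[OF assms(1)] by blast
  have uniq: "T' = bottleneck_edges w S" if "min_spanning_tree w S T'" for T'
    using min_spanning_tree_eq_bottleneck_edges[OF assms that] .
  have "MST w S = (THE T. min_spanning_tree w S T)"
    by (simp add: MST_def min_spanning_tree_def)
  also have "\<dots> = bottleneck_edges w S"
    using T uniq by (intro the_equality) auto
  finally show ?thesis .
qed

text \<open>\<open>A\<close> is the component of \<open>u\<close> among the lighter edges of
  \<open>G[V - X]\<close>. A lighter edge leaving \<open>A\<close> must end in \<open>X\<close>,
  since otherwise it would extend the component. Nothing else about spanning trees enters the
  count.\<close>

lemma M_separation:
  assumes "finite V" "\<And>e. e \<in> all_edges V \<Longrightarrow> w e > 0" "inj_on w (all_edges V)" "e \<in> M w V k"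
  obtains X A u v where "X \<subseteq> V" "card X = k - 1" "A \<subseteq> V - X" "e = {u, v}"
    "u \<in> A" "v \<in> V - X" "v \<notin> A"
    "\<And>x y. {x, y} \<in> all_edges V \<Longrightarrow> w {x, y} < w e \<Longrightarrow> x \<in> A \<Longrightarrow> y \<notin> A \<Longrightarrow> y \<in> X"
proof -
  obtain X where X: "X \<subseteq> V" "card X = k - 1" "e \<in> MST w (V - X)"
    using assms(4) by (auto simp: M_def)
  let ?S = "V - X"
  have sub: "all_edges ?S \<subseteq> all_edges V" by (rule all_edges_mono) blast
  have "MST w ?S = bottleneck_edges w ?S"
    using assms(1-3) sub by (intro MST_eq_bottleneck_edges) (auto intro: inj_on_subset)
  then have e: "e \<in> bottleneck_edges w ?S" using X(3) by simp
  then obtain u v where uv: "e = {u, v}" "u \<in> ?S" "v \<in> ?S"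
    by (auto simp: bottleneck_edges_def elim: all_edgesE)
  let ?A = "{z. (u, z) \<in> (adj (lighter w ?S e))\<^sup>*}"
  have A: "?A \<subseteq> ?S"
  proof
    fix z assume "z \<in> ?A"
    then have "(u, z) \<in> (adj (lighter w ?S e))\<^sup>*" by (rule CollectD)
    moreover have "lighter w ?S e \<subseteq> all_edges ?S" by (auto simp: lighter_def)
    ultimately show "z \<in> ?S" using uv(2) by (rule adj_rtrancl_all_edges)
  qed
  show ?thesis
  proof (rule that[OF X(1,2) A uv(1) _ uv(3)])
    show "u \<in> ?A" by simp
    show "v \<notin> ?A" using e uv(1) by (auto simp: bottleneck_edges_def)
    fix x y assume xy: "{x, y} \<in> all_edges V" "w {x, y} < w e" "x \<in> ?A" "y \<notin> ?A"
    show "y \<in> X"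
    proof (rule ccontr)
      assume "y \<notin> X"
      then have "{x, y} \<in> lighter w ?S e"
        using xy(1-3) A by (auto simp: lighter_def all_edges_doubleton_iff)
      then have "(x, y) \<in> (adj (lighter w ?S e))\<^sup>*" by (rule adj_rtrancl_edge)
      then show False using xy(3,4) by (auto intro: rtrancl_trans)
    qed
  qed
qed

section \<open>Linear independence of the motions\<close>

text \<open>Gaussian elimination: equation \<open>i\<close> is solved for an unknown
  \<open>j0\<close> with nonzero coefficient, leaving one equation and one unknown fewer.\<close>

lemma homogeneous_system_nontrivial:
  fixes c :: "'j \<Rightarrow> 'i \<Rightarrow> 'b :: field"
  assumes "finite I" "finite J" "card I < card J"
  shows "\<exists>x. (\<exists>j\<in>J. x j \<noteq> 0) \<and> (\<forall>i\<in>I. (\<Sum>j\<in>J. x j * c j i) = 0)"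
  using assms
proof (induction I arbitrary: J c rule: finite_induct)
  case empty
  then have "J \<noteq> {}" by auto
  then show ?case by (intro exI[of _ "\<lambda>_. 1"]) auto
next
  case (insert i I)
  show ?case
  proof (cases "\<forall>j\<in>J. c j i = 0")
    case True
    have "card I < card J" using insert by simp
    then obtain x where "\<exists>j\<in>J. x j \<noteq> 0" "\<forall>i\<in>I. (\<Sum>j\<in>J. x j * c j i) = 0"
      using insert.IH[OF insert.prems(1)] by blast
    then show ?thesis using True by (intro exI[of _ x]) auto
  next
    case False
    then obtain j0 where j0: "j0 \<in> J" "c j0 i \<noteq> 0" by blast
    let ?J = "J - {j0}"
    let ?c = "\<lambda>j i'. c j i' - c j i / c j0 i * c j0 i'"
    have "card I < card ?J" using insert j0(1) by simp
    then obtain x where x: "\<exists>j\<in>?J. x j \<noteq> 0" "\<forall>i'\<in>I. (\<Sum>j\<in>?J. x j * ?c j i') = 0"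
      using insert.IH[of ?J ?c] insert.prems(1) by blast
    \<comment> \<open>Giving unknown \<open>j0\<close> the value \<open>- s\<close> makes equation
      \<open>i\<close> hold.\<close>
    define s where "s = (\<Sum>j\<in>?J. x j * c j i) / c j0 i"
    define y where "y = x(j0 := - s)"
    have y: "(\<Sum>j\<in>J. y j * c j i') = (\<Sum>j\<in>?J. x j * c j i') - s * c j0 i'" for i'
      using j0(1) insert.prems(1) by (simp add: sum.remove[of J j0] y_def)
    have "(\<Sum>j\<in>J. y j * c j i') = 0" if "i' \<in> insert i I" for i'
    proof (cases "i' = i")
      case True
      then show ?thesis using j0(2) by (simp add: y s_def)
    next
      case False
      then have "(\<Sum>j\<in>?J. x j * ?c j i') = 0" using x(2) that by blast
      also have "(\<Sum>j\<in>?J. x j * ?c j i') = (\<Sum>j\<in>?J. x j * c j i') - s * c j0 i'"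
        by (simp add: s_def algebra_simps sum_subtractf sum_distrib_left sum_divide_distrib)
      finally show ?thesis by (simp add: y)
    qed
    moreover have "\<exists>j\<in>J. y j \<noteq> 0" using x(1) by (auto simp: y_def)
    ultimately show ?thesis by blast
  qed
qed

section \<open>Motions coming from symmetric matrices\<close>

lemma card_le_pairs: "card {(a, b). a \<le> b \<and> b < (k::nat)} = (k + 1) choose 2"
proof (induction k)
  case (Suc k)
  have "{(a, b). a \<le> b \<and> b < Suc k} = {(a, b). a \<le> b \<and> b < k} \<union> (\<lambda>a. (a, k)) ` {..k}"
    by auto
  moreover have "finite {(a, b). a \<le> b \<and> b < k}"
    by (rule finite_subset[of _ "{..k} \<times> {..k}"]) auto
  moreover have "{(a, b). a \<le> b \<and> b < k} \<inter> (\<lambda>a. (a, k)) ` {..k} = {}" by auto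
  moreover have "card ((\<lambda>a. (a, k)) ` {..k}) = Suc k"
    by (subst card_image) (auto simp: inj_on_def)
  ultimately show ?case using Suc by (simp add: card_Un_disjoint numeral_2_eq_2)
qed simp

text \<open>The motion of the elementary symmetric matrix with ones at \<open>(a, b)\<close> and
  \<open>(b, a)\<close>; the index \<open>(v, j)\<close> is coordinate \<open>j\<close> at vertex
  \<open>v\<close>. For \<open>a = b\<close> the order of the tests yields a single diagonal
  one.\<close>

definition symmetric_column :: "('a \<Rightarrow> real) \<Rightarrow> nat \<times> nat \<Rightarrow> 'a \<times> nat \<Rightarrow> real" where
  "symmetric_column t = (\<lambda>(a, b) (v, j). if j = b then t v ^ a else if j = a then t v ^ b else 0)"

text \<open>Both sides are values of the bilinear form of a symmetric matrix, with its arguments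
  swapped.\<close>

lemma symmetric_column_balanced:
  assumes "a < k" "b < k"
  shows "(\<Sum>j<k. symmetric_column t (a, b) (x, j) * t y ^ j) =
         (\<Sum>j<k. symmetric_column t (a, b) (y, j) * t x ^ j)"
proof -
  have *: "(\<Sum>j<k. symmetric_column t (a, b) (x, j) * t y ^ j) =
      (if a = b then t x ^ a * t y ^ a else t x ^ a * t y ^ b + t x ^ b * t y ^ a)" for x y
  proof -
    have "(\<Sum>j<k. symmetric_column t (a, b) (x, j) * t y ^ j) =
        (\<Sum>j<k. (if j = b then t x ^ a * t y ^ b else 0) +
                (if j = a then if a = b then 0 else t x ^ b * t y ^ a else 0))"
      by (intro sum.cong) (auto simp: symmetric_column_def)
    also have "\<dots> = (\<Sum>j<k. if j = b then t x ^ a * t y ^ b else 0) +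
        (\<Sum>j<k. if j = a then if a = b then 0 else t x ^ b * t y ^ a else 0)"
      by (rule sum.distrib)
    finally show ?thesis using assms by (simp add: sum.delta)
  qed
  show ?thesis unfolding * by (simp add: mult.commute)
qed

lemma poly_lessThan:
  assumes "degree p < k"
  shows "(\<Sum>j<k. coeff p j * x ^ j) = poly p (x :: 'b :: comm_semiring_1)"
  unfolding poly_altdef
  using assms by (intro sum.mono_neutral_right) (auto simp: coeff_eq_0)

text \<open>Coordinate \<open>b\<close> of the combined motion at \<open>v\<close> is a polynomial
  in \<open>t v\<close> of degree below \<open>k\<close>, whose coefficients form row
  \<open>b\<close> of the symmetric matrix. It vanishes at \<open>card V\<close> distinct points,
  and \<open>k \<le> card V\<close>, so the row is zero.\<close>

lemma symmetric_columns_independent: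
  assumes "finite V" "k \<le> card V" "inj_on t V"
    and zero: "\<And>v j. v \<in> V \<Longrightarrow> j < k \<Longrightarrow>
          (\<Sum>p\<in>{(a, b). a \<le> b \<and> b < k}. y p * symmetric_column t p (v, j)) = 0"
    and ab: "a \<le> b" "b < k"
  shows "y (a, b) = 0"
proof -
  let ?P = "{(a, b). a \<le> b \<and> b < k}"
  \<comment> \<open>Where the matrix entry in row \<open>b\<close> and column \<open>i\<close> is
    stored in the upper triangle.\<close>
  let ?h = "\<lambda>i. (min i b, max i b)"
  define p where "p = (\<Sum>i<k. monom (y (?h i)) i)"
  have finP: "finite ?P" by (rule finite_subset[of _ "{..k} \<times> {..k}"]) auto
  have coeff_p: "coeff p i = (if i < k then y (?h i) else 0)" for i
    by (simp add: p_def coeff_sum)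
  have "poly p (t v) = 0" if v: "v \<in> V" for v
  proof -
    have "poly p (t v) = (\<Sum>i<k. y (?h i) * t v ^ i)"
      by (simp add: p_def poly_sum poly_monom)
    also have "\<dots> = (\<Sum>i<k. y (?h i) * symmetric_column t (?h i) (v, b))"
      by (intro sum.cong) (auto simp: symmetric_column_def min_def max_def)
    also have "\<dots> = (\<Sum>q\<in>?h ` {..<k}. y q * symmetric_column t q (v, b))"
      by (subst sum.reindex) (auto simp: inj_on_def min_def max_def split: if_splits)
    also have "\<dots> = (\<Sum>q\<in>?P. y q * symmetric_column t q (v, b))"
    proof (intro sum.mono_neutral_left finP ballI)
      show "?h ` {..<k} \<subseteq> ?P" using ab(2) by auto
      fix q assume q: "q \<in> ?P - ?h ` {..<k}"
      obtain c d where cd: "q = (c, d)" by (cases q)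
      \<comment> \<open>Every pair in \<open>?P\<close> containing \<open>b\<close> has the form
        \<open>?h i\<close>, so the remaining columns are zero in coordinate
        \<open>b\<close>.\<close>
      have "(c, d) \<noteq> ?h c" "(c, d) \<noteq> ?h d"
        using q cd by auto
      then have "c \<noteq> b" "d \<noteq> b" using q cd by auto
      then show "y q * symmetric_column t q (v, b) = 0" by (simp add: cd symmetric_column_def)
    qed
    also have "\<dots> = 0" using zero[OF v ab(2)] .
    finally show ?thesis .
  qed
  then have roots: "t ` V \<subseteq> {x. poly p x = 0}" by auto
  have "p = 0"
  proof (rule ccontr)
    assume "p \<noteq> 0"
    have "card V = card (t ` V)" using assms(3) by (simp add: card_image)
    also have "\<dots> \<le> card {x. poly p x = 0}"
      using roots poly_roots_finite[OF \<open>p \<noteq> 0\<close>] by (rule card_mono[rotated])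
    also have "\<dots> \<le> degree p" using \<open>p \<noteq> 0\<close> by (rule card_poly_roots_bound)
    also have "degree p < k"
      using \<open>p \<noteq> 0\<close> coeff_p[of "degree p"] by (auto split: if_splits)
    finally show False using assms(2) by simp
  qed
  then have "coeff p a = 0" by simp
  then show ?thesis using ab coeff_p[of a] by simp
qed

section \<open>Motions attached to separated edges\<close>

definition vanishing_poly :: "('a \<Rightarrow> real) \<Rightarrow> 'a set \<Rightarrow> real poly" where
  "vanishing_poly t X = (\<Prod>x\<in>X. [:- t x, 1:])"

text \<open>With \<open>a\<close> the coefficient vector, this is the motion of the rank-one
  symmetric matrix formed by the products \<open>a i * a j\<close>, switched off outside
  \<open>A\<close>. Hence it can violate the symmetric balance only across the boundary of
  \<open>A\<close>.\<close>

definition cut_column :: "('a \<Rightarrow> real) \<Rightarrow> 'a set \<Rightarrow> 'a set \<Rightarrow> 'a \<times> nat \<Rightarrow> real" where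
  "cut_column t X A = (\<lambda>(v, j).
     if v \<in> A then poly (vanishing_poly t X) (t v) * coeff (vanishing_poly t X) j else 0)"

lemma degree_vanishing_poly: "degree (vanishing_poly t X) = card X"
  unfolding vanishing_poly_def by (subst degree_prod_eq_sum_degree) auto

lemma poly_vanishing_poly_eq_0_iff:
  "finite X \<Longrightarrow> poly (vanishing_poly t X) z = 0 \<longleftrightarrow> (\<exists>x\<in>X. z = t x)"
  by (auto simp: vanishing_poly_def poly_prod)

lemma cut_column_pairing:
  assumes "card X < k"
  shows "(\<Sum>j<k. cut_column t X A (x, j) * t y ^ j) =
    (if x \<in> A then poly (vanishing_poly t X) (t x) * poly (vanishing_poly t X) (t y) else 0)"
  using assms
  by (simp add: cut_column_def poly_lessThan[symmetric, of "vanishing_poly t X" k "t y"]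
      degree_vanishing_poly sum_distrib_left mult.assoc)

text \<open>Independence comes from triangularity in the weights: the functional of an edge kills
  the motions of all heavier edges in \<open>F\<close>, but not its own.\<close>

lemma card_separated_edges_bound:
  fixes w :: "'a set \<Rightarrow> real" and u v :: "'a set \<Rightarrow> 'a"
  assumes "finite V" "1 \<le> k" "k \<le> card V" "F \<subseteq> all_edges V" "inj_on w F"
    and X: "\<And>e. e \<in> F \<Longrightarrow> X e \<subseteq> V" "\<And>e. e \<in> F \<Longrightarrow> card (X e) = k - 1"
    and uv: "\<And>e. e \<in> F \<Longrightarrow> e = {u e, v e}" "\<And>e. e \<in> F \<Longrightarrow> u e \<in> A e - X e"
      "\<And>e. e \<in> F \<Longrightarrow> v e \<notin> A e \<union> X e"
    and sep: "\<And>e x y. e \<in> F \<Longrightarrow> {x, y} \<in> F \<Longrightarrow> w {x, y} < w e \<Longrightarrow> x \<in> A e \<Longrightarrow> y \<notin> A e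
      \<Longrightarrow> y \<in> X e"
  shows "card F + ((k + 1) choose 2) \<le> card V * k"
proof (rule ccontr)
  assume large: "\<not> ?thesis"
  let ?P = "{(a, b). a \<le> b \<and> b < k}"
  have finP: "finite ?P" by (rule finite_subset[of _ "{..k} \<times> {..k}"]) auto
  have finF: "finite F" using assms(1,4) finite_all_edges finite_subset by blast
  obtain t :: "'a \<Rightarrow> real" where t: "inj_on t V"
  proof -
    obtain h :: "'a \<Rightarrow> nat" where "inj_on h V"
      using finite_imp_inj_to_nat_seg[OF assms(1)] by blast
    then show ?thesis by (intro that[of "real \<circ> h"]) (auto simp: inj_on_def)
  qed
  define c where "c = case_sum (\<lambda>e. cut_column t (X e) (A e)) (symmetric_column t)"
  \<comment> \<open>If the bound fails, there are more columns than coordinates, so some nontrivial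
    relation \<open>z\<close> holds.\<close>
  have "card (V \<times> {..<k}) < card (F <+> ?P)"
    using large finF finP by (simp add: card_Plus card_le_pairs card_cartesian_product)
  then obtain z where z: "\<exists>j\<in>F <+> ?P. z j \<noteq> 0"
      "\<forall>i\<in>V \<times> {..<k}. (\<Sum>j\<in>F <+> ?P. z j * c j i) = 0"
    using homogeneous_system_nontrivial[of "V \<times> {..<k}" "F <+> ?P" c] assms(1) finF finP by auto
  have rel: "(\<Sum>e\<in>F. z (Inl e) * cut_column t (X e) (A e) (x, j)) +
      (\<Sum>p\<in>?P. z (Inr p) * symmetric_column t p (x, j)) = 0" if "x \<in> V" "j < k" for x j
    using z(2) that finF finP by (force simp: sum.Plus c_def)
  \<comment> \<open>The functional of the edge xy.\<close>
  define Q where "Q m x y = (\<Sum>j<k. m (x, j) * t y ^ j) - (\<Sum>j<k. m (y, j) * t x ^ j)"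
    for m :: "'a \<times> nat \<Rightarrow> real" and x y
  have Q_sym: "Q (symmetric_column t p) x y = 0" if "p \<in> ?P" for p x y
    using that symmetric_column_balanced[of "fst p" k "snd p"] by (auto simp: Q_def)
  have Q_cut: "Q (cut_column t (X e) (A e)) x y =
      poly (vanishing_poly t (X e)) (t x) * poly (vanishing_poly t (X e)) (t y) *
      (of_bool (x \<in> A e) - of_bool (y \<in> A e))" if "e \<in> F" for e x y
    using X(2)[OF that] assms(2) by (auto simp: Q_def cut_column_pairing)
  have Q_rel: "(\<Sum>e\<in>F. z (Inl e) * Q (cut_column t (X e) (A e)) x y) = 0"
    if "x \<in> V" "y \<in> V" for x y
  proof -
    let ?m = "\<lambda>i. (\<Sum>e\<in>F. z (Inl e) * cut_column t (X e) (A e) i) +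
      (\<Sum>p\<in>?P. z (Inr p) * symmetric_column t p i)"
    have expand: "(\<Sum>j<k. ?m (x, j) * t y ^ j) =
      (\<Sum>e\<in>F. z (Inl e) * (\<Sum>j<k. cut_column t (X e) (A e) (x, j) * t y ^ j)) +
      (\<Sum>p\<in>?P. z (Inr p) * (\<Sum>j<k. symmetric_column t p (x, j) * t y ^ j))" for x y
      unfolding distrib_right sum.distrib sum_distrib_right sum_distrib_left mult.assoc
      by (intro arg_cong2[of _ _ _ _ "(+)"] sum.swap)
    have "Q ?m x y = 0"
      using that rel by (simp add: Q_def)
    moreover have "Q ?m x y = (\<Sum>e\<in>F. z (Inl e) * Q (cut_column t (X e) (A e)) x y) +
        (\<Sum>p\<in>?P. z (Inr p) * Q (symmetric_column t p) x y)"
      unfolding Q_def expand right_diff_distrib sum_subtractf by simp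
    moreover have "(\<Sum>p\<in>?P. z (Inr p) * Q (symmetric_column t p) x y) = 0"
      using Q_sym by (intro sum.neutral) simp
    ultimately show ?thesis by simp
  qed
  have "z (Inl e) = 0" if "e \<in> F" for e
  proof (rule ccontr)
    assume "z (Inl e) \<noteq> 0"
    let ?N = "{e \<in> F. z (Inl e) \<noteq> 0}"
    \<comment> \<open>Choosing the lightest edge with nonzero coefficient makes every other
      surviving edge heavier, so \<open>sep\<close> applies with \<open>f\<close> as the lighter
      edge.\<close>
    define f where "f = arg_min_on w ?N"
    have "finite ?N" "?N \<noteq> {}" using finF that \<open>z (Inl e) \<noteq> 0\<close> by auto
    then have "f \<in> ?N" and f_min: "\<forall>e\<in>?N. w f \<le> w e"
      unfolding f_def using arg_min_if_finite(1)[of ?N w] arg_min_least[of ?N _ w] by blast+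
    then have f: "f \<in> F" "z (Inl f) \<noteq> 0" by auto
    have fV: "u f \<in> V" "v f \<in> V"
      using f(1) assms(4) uv(1)[OF f(1)] by (auto simp: all_edges_def)
    have finX: "finite (X e)" if "e \<in> F" for e
      using X(1)[OF that] assms(1) finite_subset by blast
    have "z (Inl e) * Q (cut_column t (X e) (A e)) (u f) (v f) = 0" if e: "e \<in> F - {f}" for e
    proof (cases "z (Inl e) = 0")
      case False
      then have "w f \<le> w e" using f_min e by blast
      moreover have "w f \<noteq> w e" using assms(5) e f(1) by (auto dest: inj_onD)
      ultimately have less: "w f < w e" by simp
      \<comment> \<open>Either end of \<open>f\<close> may be the one inside \<open>A e\<close>,
        whereas \<open>sep\<close> is directed from inside to outside.\<close>
      have f_eq: "f = {u f, v f}" "f = {v f, u f}"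
        using uv(1)[OF f(1)] by (auto simp: insert_commute)
      have "u f \<in> X e \<or> v f \<in> X e" if "(u f \<in> A e) \<noteq> (v f \<in> A e)"
        using that sep[of e "u f" "v f"] sep[of e "v f" "u f"] e f(1) less f_eq by auto
      then have "Q (cut_column t (X e) (A e)) (u f) (v f) = 0"
        using e finX[of e] by (auto simp: Q_cut poly_vanishing_poly_eq_0_iff)
      then show ?thesis by simp
    qed simp
    then have "(\<Sum>e\<in>F - {f}. z (Inl e) * Q (cut_column t (X e) (A e)) (u f) (v f)) = 0"
      by (rule sum.neutral[OF ballI])
    then have "(\<Sum>e\<in>F. z (Inl e) * Q (cut_column t (X e) (A e)) (u f) (v f)) =
        z (Inl f) * Q (cut_column t (X f) (A f)) (u f) (v f)"
      using finF f(1) by (simp add: sum.remove[of F f])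
    then have "Q (cut_column t (X f) (A f)) (u f) (v f) = 0"
      using Q_rel[OF fV] f(2) by simp
    \<comment> \<open>For \<open>f\<close> itself neither end lies in \<open>X f\<close> and exactly
      one lies in \<open>A f\<close>, so its functional does not vanish.\<close>
    moreover have "poly (vanishing_poly t (X f)) (t y) \<noteq> 0" if "y \<in> V - X f" for y
      using that finX[OF f(1)] X(1)[OF f(1)] t
      by (auto simp: poly_vanishing_poly_eq_0_iff dest!: inj_onD)
    ultimately show False using uv(2,3)[OF f(1)] fV f(1) by (auto simp: Q_cut)
  qed
  \<comment> \<open>With the edge coefficients gone, only a relation among symmetric columns is
    left.\<close>
  moreover from this have "z (Inr p) = 0" if "p \<in> ?P" for p
    using that rel
      symmetric_columns_independent[OF assms(1,3) t, where y = "\<lambda>p. z (Inr p)"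
        and a = "fst p" and b = "snd p"]
    by auto
  ultimately show False using z(1) by auto
qed

theorem theorem1:
  fixes V :: "'a set" and w :: "'a set \<Rightarrow> real" and n k :: nat
  assumes "finite V" and "card V = n" and "n \<ge> 2"
    and "\<And>e. e \<in> all_edges V \<Longrightarrow> w e > 0"
    and "inj_on w (all_edges V)"
    and "1 \<le> k" and "k \<le> n - 1"
  shows "card (M w V k) \<le> n * k - ((k + 1) choose 2)"
proof -
  have "\<forall>e\<in>M w V k. \<exists>X A u v. X \<subseteq> V \<and> card X = k - 1 \<and> A \<subseteq> V - X \<and> e = {u, v} \<and>
      u \<in> A \<and> v \<in> V - X \<and> v \<notin> A \<and>
      (\<forall>x y. {x, y} \<in> all_edges V \<longrightarrow> w {x, y} < w e \<longrightarrow> x \<in> A \<longrightarrow> y \<notin> A \<longrightarrow> y \<in> X)"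
  proof
    fix e assume "e \<in> M w V k"
    from M_separation[OF assms(1,4,5) this]
    obtain X A u v where "X \<subseteq> V" "card X = k - 1" "A \<subseteq> V - X" "e = {u, v}"
      "u \<in> A" "v \<in> V - X" "v \<notin> A"
      "\<And>x y. {x, y} \<in> all_edges V \<Longrightarrow> w {x, y} < w e \<Longrightarrow> x \<in> A \<Longrightarrow> y \<notin> A \<Longrightarrow> y \<in> X"
      by metis
    then show "\<exists>X A u v. X \<subseteq> V \<and> card X = k - 1 \<and> A \<subseteq> V - X \<and> e = {u, v} \<and>
      u \<in> A \<and> v \<in> V - X \<and> v \<notin> A \<and>
      (\<forall>x y. {x, y} \<in> all_edges V \<longrightarrow> w {x, y} < w e \<longrightarrow> x \<in> A \<longrightarrow> y \<notin> A \<longrightarrow> y \<in> X)"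
      by blast
  qed
  then obtain X A u v where sep: "\<forall>e\<in>M w V k. X e \<subseteq> V \<and> card (X e) = k - 1 \<and>
      A e \<subseteq> V - X e \<and> e = {u e, v e} \<and> u e \<in> A e \<and> v e \<in> V - X e \<and> v e \<notin> A e \<and>
      (\<forall>x y. {x, y} \<in> all_edges V \<longrightarrow> w {x, y} < w e \<longrightarrow> x \<in> A e \<longrightarrow> y \<notin> A e \<longrightarrow> y \<in> X e)"
    unfolding bchoice_iff by (elim exE) (rule that)
  have X: "X e \<subseteq> V" "card (X e) = k - 1" and A: "A e \<subseteq> V - X e" and e: "e = {u e, v e}"
    and uv: "u e \<in> A e" "v e \<in> V - X e" "v e \<notin> A e"
    and cut: "\<forall>x y. {x, y} \<in> all_edges V \<longrightarrow> w {x, y} < w e \<longrightarrow> x \<in> A e \<longrightarrow> y \<notin> A e \<longrightarrow> y \<in> X e"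
    if "e \<in> M w V k" for e
    by (insert bspec[OF sep that]) ((elim conjE, assumption)+)
  have sub: "M w V k \<subseteq> all_edges V"
  proof
    fix f assume f: "f \<in> M w V k"
    have "u f \<in> V" "v f \<in> V" "u f \<noteq> v f" using A[OF f] uv[OF f] by auto
    then have "{u f, v f} \<in> all_edges V" by (simp add: all_edges_doubleton_iff)
    with e[OF f, symmetric] show "f \<in> all_edges V" by (rule subst)
  qed
  \<comment> \<open>The additive form yields the claim despite truncated subtraction on
    \<open>nat\<close>.\<close>
  have "card (M w V k) + ((k + 1) choose 2) \<le> card V * k"
  proof (rule card_separated_edges_bound[where X = X and A = A and u = u and v = v and w = w])
    show "k \<le> card V" using assms(2,3,7) by simp
    show "inj_on w (M w V k)" using assms(5) sub by (rule inj_on_subset)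
    show "e = {u e, v e}" if "e \<in> M w V k" for e using that by (rule e)
    show "u e \<in> A e - X e" "v e \<notin> A e \<union> X e" if "e \<in> M w V k" for e
      using A[OF that] uv[OF that] by auto
    show "y \<in> X e" if "e \<in> M w V k" "{x, y} \<in> M w V k" "w {x, y} < w e" "x \<in> A e" "y \<notin> A e"
      for e x y using cut[OF that(1)] that(2-) sub by blast
  qed (fact assms(1,6) sub X)+
  then show ?thesis using assms(2) by simp
qed

end
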